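(* For $v\in\mathbb{N}^n$ $(n\ge 1)$, the multinomial lattice $\mathcal{L}(v)$ is meet semidistributive at $k$ for every $k\ge n-1$; that is, it satisfies the equation $SD_k(\land)$ for every $k\ge n-1$.
   Context: $\mathbb{N}$ is the set of non-negative integers. For $v=(v_1,\ldots,v_n)\in\mathbb{N}^n$, $\mathcal{L}(v)$ is the set of words over the alphabet $\{a_1,\ldots,a_n\}$ in which each letter $a_i$ occurs exactly $v_i$ times. It is ordered by the reflexive and transitive closure of the relation $\rightarrow$, where $w\rightarrow u$ iff $w=w_1a_ia_jw_2$ and $u=w_1a_ja_iw_2$ for some words $w_1,w_2$ and some $i<j$. This ordered set is a lattice. The dimension $n$ is a positive integer. Given variables $x,y,z$, define lattice terms by $y_0=y$, $z_0=z$, $y_{m+1}=y\vee(x\land z_m)$, $z_{m+1}=z\vee(x\land y_m)$. For $m\ge 0$, $SD_m(\land)$ is the equation $x\land y_m=x\land(y\vee z)$. A lattice is meet semidistributive at $m$ if it satisfies $SD_m(\land)$ for all values of $x,y,z$. *)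

theory Defs
  imports "HOL-Algebra.Lattice"
begin

section \<open>Multinomial lattices\<close>

text \<open>The letter $a_i$ is encoded by its index $i$, so words are lists of natural numbers.
  A vector $(v_1, \ldots, v_n)$ is given by \<open>n\<close> and the values of \<open>v :: nat \<Rightarrow> nat\<close>
  on \<open>{1..n}\<close>; the other values of \<open>v\<close> are irrelevant.\<close>

definition multinomial_words :: "nat \<Rightarrow> (nat \<Rightarrow> nat) \<Rightarrow> nat list set" where
  "multinomial_words n v = {w. set w \<subseteq> {1..n} \<and> (\<forall>i\<in>{1..n}. count_list w i = v i)}"

inductive swap_step :: "nat list \<Rightarrow> nat list \<Rightarrow> bool" where
  "i < j \<Longrightarrow> swap_step (w1 @ [i, j] @ w2) (w1 @ [j, i] @ w2)"

definition multinomial_lattice :: "nat \<Rightarrow> (nat \<Rightarrow> nat) \<Rightarrow> nat list gorder" where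
  "multinomial_lattice n v =
     \<lparr>carrier = multinomial_words n v, eq = (=), le = swap_step\<^sup>*\<^sup>*\<rparr>"

section \<open>Meet semidistributivity at \<open>m\<close>\<close>

fun sd_y :: "('a, 'b) gorder_scheme \<Rightarrow> 'a \<Rightarrow> 'a \<Rightarrow> 'a \<Rightarrow> nat \<Rightarrow> 'a"
  and sd_z :: "('a, 'b) gorder_scheme \<Rightarrow> 'a \<Rightarrow> 'a \<Rightarrow> 'a \<Rightarrow> nat \<Rightarrow> 'a" where
  "sd_y L x y z 0 = y"
| "sd_y L x y z (Suc m) = y \<squnion>\<^bsub>L\<^esub> (x \<sqinter>\<^bsub>L\<^esub> sd_z L x y z m)"
| "sd_z L x y z 0 = z"
| "sd_z L x y z (Suc m) = z \<squnion>\<^bsub>L\<^esub> (x \<sqinter>\<^bsub>L\<^esub> sd_y L x y z m)"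

definition SD_meet :: "('a, 'b) gorder_scheme \<Rightarrow> nat \<Rightarrow> bool" where
  "SD_meet L m \<longleftrightarrow>
     (\<forall>x\<in>carrier L. \<forall>y\<in>carrier L. \<forall>z\<in>carrier L.
        x \<sqinter>\<^bsub>L\<^esub> sd_y L x y z m = x \<sqinter>\<^bsub>L\<^esub> (y \<squnion>\<^bsub>L\<^esub> z))"

text \<open>The conjunct \<open>lattice L\<close> is needed because \<open>\<squnion>\<close> and \<open>\<sqinter>\<close> are total functions defined
  by choice, so \<open>SD_meet\<close> alone does not have its intended meaning if \<open>L\<close> is not a lattice.\<close>

definition meet_semidistributive_at :: "('a, 'b) gorder_scheme \<Rightarrow> nat \<Rightarrow> bool" where
  "meet_semidistributive_at L m \<longleftrightarrow> lattice L \<and> SD_meet L m"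

end

theory Submission
  imports Defs "HOL-Library.Product_Lexorder"
begin

text \<open>Distinguish the copies of each letter and record a word by its inversions: the pairs of
  copies \<open>a\<close>, \<open>b\<close> of letters \<open>i < j\<close> such that \<open>b\<close> is read before \<open>a\<close>. As for the weak order on
  permutations, the order of the multinomial lattice is inclusion of inversion sets
  (\<open>swap_steps_iff_inversions\<close>), and the inversion sets are the sets of pairs of copies of
  different letters that are closed and coclosed under composition (\<open>biclosed_inversions\<close>,
  \<open>biclosed_realizable\<close>). Consequently the inversions of a join form the transitive closure of
  the union, and those of a meet are what remains after removing the transitive closure of the
  union of the two sets of non-inversions.

  Let \<open>w = x \<sqinter> (y \<squnion> z)\<close>. Because \<open>y\<^sub>k\<close> lies below \<open>y \<squnion> z\<close>, the equation says that every
  inversion of \<open>w\<close> is one of \<open>y\<^sub>k\<close>. An inversion relates letters that differ by at most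
  \<open>n - 1\<close>, so it is enough to show by induction on \<open>m\<close> that the inversions of \<open>w\<close> whose letters
  differ by at most \<open>m\<close> belong to both \<open>y\<^sub>m\<close> and \<open>z\<^sub>m\<close> (\<open>narrow_inversions_sd\<close>). Let \<open>(a, b)\<close>
  be one whose letters differ by at most \<open>m + 1\<close>.

  As \<open>w \<le> y \<squnion> z\<close>, there is a chain from \<open>a\<close> to \<open>b\<close> all of whose steps are inversions of \<open>y\<close> or
  of \<open>z\<close>. For each interior point \<open>c\<close>, coclosedness puts \<open>(a, c)\<close> or \<open>(c, b)\<close> into \<open>w\<close>; hence the
  chain has a step \<open>(c, d)\<close> such that \<open>(a, c)\<close> and \<open>(d, b)\<close> are in \<open>w\<close> or trivial. Both of these
  are narrower, so by induction they belong to \<open>y\<^sub>m\<close> and to \<open>z\<^sub>m\<close>. If the step \<open>(c, d)\<close> comes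
  from \<open>y\<close>, then \<open>(a, b)\<close> is in \<open>y\<^sub>m\<close>; if it comes from \<open>z\<close>, then \<open>(a, b)\<close> is in \<open>z\<^sub>m\<close>
  (\<open>join_pair_one_side\<close>). In the second case \<open>(a, b)\<close> is even an inversion of \<open>x \<sqinter> z\<^sub>m\<close>, because
  any chain from \<open>a\<close> to \<open>b\<close> has a step in \<open>w\<close>, and that step is in \<open>x\<close> and in \<open>z\<^sub>m\<close>
  (\<open>meet_pair\<close>). So in both cases \<open>(a, b)\<close> is an inversion of \<open>y\<^bsub>m+1\<^esub>\<close>, and symmetrically of
  \<open>z\<^bsub>m+1\<^esub>\<close>.\<close>

section \<open>Biclosed sets of pairs\<close>

definition biclosed :: "'a::linorder set \<Rightarrow> ('a \<times> 'a) set \<Rightarrow> bool" where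
  "biclosed E T \<longleftrightarrow> (\<forall>a b. (a, b) \<in> T \<longrightarrow> a \<in> E \<and> b \<in> E \<and> a < b) \<and> trans T \<and>
     (\<forall>a b d. (a, b) \<in> T \<longrightarrow> d \<in> E \<longrightarrow> a < d \<longrightarrow> d < b \<longrightarrow> (a, d) \<in> T \<or> (d, b) \<in> T)"

definition co_pairs :: "'a::linorder set \<Rightarrow> ('a \<times> 'a) set \<Rightarrow> ('a \<times> 'a) set" where
  "co_pairs E T = {(a, b). a \<in> E \<and> b \<in> E \<and> a < b \<and> (a, b) \<notin> T}"

lemma biclosedD:
  assumes "biclosed E T" and "(a, b) \<in> T"
  shows "a \<in> E" and "b \<in> E" and "a < b"
  using assms unfolding biclosed_def by blast+

lemma biclosed_trans: "biclosed E T \<Longrightarrow> trans T"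
  unfolding biclosed_def by blast

lemma biclosed_split:
  assumes "biclosed E T" and "(a, b) \<in> T" and "d \<in> E" and "a < d" and "d < b"
  shows "(a, d) \<in> T \<or> (d, b) \<in> T"
  using assms unfolding biclosed_def by blast

lemma biclosed_co_pairs:
  assumes "biclosed E T"
  shows "biclosed E (co_pairs E T)"
proof -
  have "trans (co_pairs E T)"
    unfolding trans_def co_pairs_def using biclosed_split[OF assms] by fastforce
  moreover have "(a, d) \<in> co_pairs E T \<or> (d, b) \<in> co_pairs E T"
    if "(a, b) \<in> co_pairs E T" "d \<in> E" "a < d" "d < b" for a b d
    using that transD[OF biclosed_trans[OF assms], of a d b] unfolding co_pairs_def by blast
  ultimately show ?thesis unfolding biclosed_def by (auto simp: co_pairs_def)
qed

text \<open>Transitive closure does not destroy coclosedness: a point \<open>d\<close> strictly between the ends of a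
  chain is passed at some step of the chain, and if it is jumped over, the step itself splits at
  \<open>d\<close>.\<close>

lemma biclosed_trancl_Un:
  assumes S: "biclosed E S" and T: "biclosed E T"
  shows "biclosed E ((S \<union> T)\<^sup>+)"
proof -
  have step: "a \<in> E \<and> b \<in> E \<and> a < b" if "(a, b) \<in> S \<union> T" for a b
    using that biclosedD[OF S] biclosedD[OF T] by blast
  have sub: "a \<in> E \<and> b \<in> E \<and> a < b" if "(a, b) \<in> (S \<union> T)\<^sup>+" for a b
    using that by induction (use step in \<open>fastforce+\<close>)
  have split: "(a, d) \<in> (S \<union> T)\<^sup>+ \<or> (d, b) \<in> (S \<union> T)\<^sup>+"
    if "(a, b) \<in> (S \<union> T)\<^sup>+" "d \<in> E" "a < d" "d < b" for a b d
    using that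
  proof (induction arbitrary: d)
    case (base b)
    then show ?case using biclosed_split[OF S, of a b d] biclosed_split[OF T, of a b d] by blast
  next
    case (step c b)
    consider "d < c" | "d = c" | "c < d" by fastforce
    then show ?case
    proof cases
      case 1
      then have "(a, d) \<in> (S \<union> T)\<^sup>+ \<or> (d, c) \<in> (S \<union> T)\<^sup>+" using step by blast
      then show ?thesis using step.hyps(2) by (meson trancl.trancl_into_trancl)
    next
      case 2
      then show ?thesis using step by blast
    next
      case 3
      then have "(c, d) \<in> S \<union> T \<or> (d, b) \<in> S \<union> T"
        using step biclosed_split[OF S, of c b d] biclosed_split[OF T, of c b d] by blast
      then show ?thesis using step.hyps(1) by (meson r_into_trancl trancl.trancl_into_trancl)
    qed
  qed
  show ?thesis unfolding biclosed_def by (intro conjI allI impI trans_trancl) (use sub split in blast)+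
qed

lemma co_pairs_antimono: "S \<subseteq> T \<Longrightarrow> co_pairs E T \<subseteq> co_pairs E S"
  by (auto simp: co_pairs_def)

text \<open>Among the sets of increasing pairs in \<open>E\<close> whose complement is transitive, the left-hand side
  is the largest one inside \<open>S \<inter> T\<close>, since the transitive closure is the smallest possible
  complement. This set plays the part of the meet.\<close>

lemma co_pairs_trancl_subset:
  "co_pairs E ((co_pairs E S \<union> co_pairs E T)\<^sup>+) \<subseteq> S \<inter> T"
proof
  fix e assume e: "e \<in> co_pairs E ((co_pairs E S \<union> co_pairs E T)\<^sup>+)"
  then have "e \<notin> co_pairs E S \<union> co_pairs E T" by (auto simp: co_pairs_def)
  then show "e \<in> S \<inter> T" using e by (auto simp: co_pairs_def)
qed

lemma trancl_Un_least:
  assumes "S \<subseteq> R" and "T \<subseteq> R" and "trans R"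
  shows "(S \<union> T)\<^sup>+ \<subseteq> R"
proof -
  have "(S \<union> T)\<^sup>+ \<subseteq> R\<^sup>+" using assms(1,2) by (intro trancl_mono_subset Un_least)
  then show ?thesis using trancl_id[OF assms(3)] by simp
qed

section \<open>Inversion sets of words\<close>

text \<open>The cell \<open>(i, p)\<close> stands for the occurrence of the letter \<open>i\<close> that is preceded by exactly \<open>p\<close>
  others. Counting occurrences in prefixes locates the cells without having to relabel the
  letters of a word.\<close>

definition cells :: "nat \<Rightarrow> (nat \<Rightarrow> nat) \<Rightarrow> (nat \<times> nat) set" where
  "cells n v = {(i, p). i \<in> {1..n} \<and> p < v i}"

definition read_by :: "nat \<Rightarrow> nat list \<Rightarrow> nat \<times> nat \<Rightarrow> bool" where
  "read_by k w e \<longleftrightarrow> snd e < count_list (take k w) (fst e)"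

definition before :: "nat list \<Rightarrow> nat \<times> nat \<Rightarrow> nat \<times> nat \<Rightarrow> bool" where
  "before w e f \<longleftrightarrow> (\<exists>k. read_by k w e \<and> \<not> read_by k w f)"

text \<open>Cells are compared lexicographically. Two cells of the same letter are pairs \<open>e < f\<close> too, but
  they are never inverted; treating them as ordinary non-inversions lets \<open>biclosed\<close> and \<open>co_pairs\<close>
  refer to a single linear order on the cells.\<close>

definition inversions :: "(nat \<times> nat) set \<Rightarrow> nat list \<Rightarrow> ((nat \<times> nat) \<times> (nat \<times> nat)) set" where
  "inversions E w = {(e, f). e \<in> E \<and> f \<in> E \<and> e < f \<and> before w f e}"

lemma count_list_take_mono:
  assumes "k \<le> l"
  shows "count_list (take k w) i \<le> count_list (take l w) i"
proof -
  have "take l w = take k w @ take (l - k) (drop k w)"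
    using assms by (metis le_add_diff_inverse take_add)
  then show ?thesis by simp
qed

lemma read_by_mono: "read_by k w e \<Longrightarrow> k \<le> l \<Longrightarrow> read_by l w e"
  unfolding read_by_def using count_list_take_mono[of k l w "fst e"] by simp

lemma before_asym: "before w e f \<Longrightarrow> \<not> before w f e"
  unfolding before_def by (metis nat_le_linear read_by_mono)

lemma before_trans: "before w e f \<Longrightarrow> before w f g \<Longrightarrow> before w e g"
  unfolding before_def by (metis nat_le_linear read_by_mono)

lemma before_split: "before w e f \<Longrightarrow> before w e d \<or> before w d f"
  unfolding before_def by blast

lemma before_same_letter: "before w (i, p) (i, q) \<Longrightarrow> p < q"
  unfolding before_def read_by_def by auto

lemma biclosed_inversions: "biclosed E (inversions E w)"
proof -
  have "trans (inversions E w)"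
    by (rule transI) (auto simp: inversions_def intro: before_trans)
  moreover have "(a, d) \<in> inversions E w \<or> (d, b) \<in> inversions E w"
    if "(a, b) \<in> inversions E w" "d \<in> E" "a < d" "d < b" for a b d
    using that before_split[of w b a d] unfolding inversions_def by blast
  ultimately show ?thesis unfolding biclosed_def by (auto simp: inversions_def)
qed

lemma inversions_fst_less:
  assumes "(e, f) \<in> inversions E w"
  shows "fst e < fst f"
proof (rule ccontr)
  assume "\<not> fst e < fst f"
  moreover have "e < f" and "before w f e" using assms by (auto simp: inversions_def)
  ultimately show False
    using before_same_letter[of w "fst e" "snd f" "snd e"] by (cases e; cases f) (auto simp: less_prod_def)
qed

text \<open>If every prefix of a list of cells contains with a cell all earlier cells of its letter, the
  cells are listed in the order in which the underlying word reads them, so the second components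
  are the ones that counting recovers.\<close>

lemma read_by_map_fst:
  assumes "distinct xs"
    and "\<And>k i p q. (i, q) \<in> set (take k xs) \<Longrightarrow> p < q \<Longrightarrow> (i, p) \<in> set (take k xs)"
  shows "e \<in> set xs \<longleftrightarrow> snd e < count_list (map fst xs) (fst e)"
  using assms
proof (induction xs arbitrary: e rule: rev_induct)
  case Nil
  then show ?case by simp
next
  case (snoc x xs)
  obtain i p where x: "x = (i, p)" by (cases x)
  have down: "(j, r) \<in> set (take k xs)" if "(j, q) \<in> set (take k xs)" "r < q" for k j q r
    
  proof -
    have "take (min k (length xs)) (xs @ [x]) = take k xs" by (simp add: min_def)
    then show ?thesis using snoc.prems(2)[of j q "min k (length xs)" r] that by simp
  qed
  have IH: "e \<in> set xs \<longleftrightarrow> snd e < count_list (map fst xs) (fst e)" for e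
  proof (rule snoc.IH)
    show "distinct xs" using snoc.prems(1) by simp
  qed (rule down)
  have "p = count_list (map fst xs) i" (is "p = ?c")
  proof (rule antisym)
    show "?c \<le> p" using IH[of "(i, p)"] snoc.prems(1) x by auto
    show "p \<le> ?c"
    proof (rule ccontr)
      assume "\<not> p \<le> ?c"
      then have "(i, ?c) \<in> set xs"
        using snoc.prems(2)[of i p "Suc (length xs)" ?c] x by auto
      then show False using IH[of "(i, ?c)"] by simp
    qed
  qed
  then show ?case using IH[of e] x by (cases e) auto
qed

lemma finite_cells: "finite (cells n v)"
proof -
  have "cells n v = (SIGMA i:{1..n}. {..<v i})" by (auto simp: cells_def)
  then show ?thesis by simp
qed

text \<open>Inverting the pairs of \<open>T\<close> and keeping all others gives a linear order on the cells: its
  transitivity is closedness and coclosedness of \<open>T\<close>, according to how the three cells are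
  arranged. Reading the cells in this order yields the word. It needs the pairs of \<open>T\<close> to have
  different letters, since otherwise equal letters would be permuted.\<close>

lemma biclosed_realizable:
  assumes T: "biclosed (cells n v) T" and letters: "\<And>e f. (e, f) \<in> T \<Longrightarrow> fst e < fst f"
  shows "\<exists>w \<in> multinomial_words n v. inversions (cells n v) w = T"
proof -
  let ?E = "cells n v"
  define B where "B e f \<longleftrightarrow> (e < f \<and> (e, f) \<notin> T) \<or> (f, e) \<in> T" for e f
  define rank where "rank e = card {d \<in> ?E. B d e}" for e
  have B_trans: "B d f" if "B d e" "B e f" "d \<in> ?E" "e \<in> ?E" "f \<in> ?E" for d e f
  proof -
    have less: "B a b \<longleftrightarrow> (a, b) \<notin> T" if "a < b" for a b
      using that biclosedD(3)[OF T, of b a] unfolding B_def by auto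
    have gr: "B a b \<longleftrightarrow> (b, a) \<in> T" if "b < a" for a b
      using that unfolding B_def by auto
    have "d \<noteq> e" "e \<noteq> f" using that biclosedD(3)[OF T] unfolding B_def by blast+
    moreover have "d \<noteq> f" using that less gr calculation by (metis neq_iff)
    ultimately consider "d < e" "e < f" "d < f" | "d < f" "f < e" "d < e" | "e < d" "d < f" "e < f"
      | "e < f" "f < d" "e < d" | "f < d" "d < e" "f < e" | "f < e" "e < d" "f < d"
      by (metis less_trans neq_iff)
    then show ?thesis
      using that biclosed_split[OF T] transD[OF biclosed_trans[OF T]]
      by cases (simp_all add: less gr, blast+)
  qed
  have B_irrefl: "\<not> B e e" for e using biclosedD(3)[OF T, of e e] unfolding B_def by auto
  have B_total: "B e f \<or> B f e" if "e \<noteq> f" for e f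
    using that unfolding B_def by (metis neq_iff)
  have rank_less: "rank e < rank f" if "B e f" "e \<in> ?E" "f \<in> ?E" for e f
    unfolding rank_def
  proof (rule psubset_card_mono)
    show "finite {d \<in> ?E. B d f}" using finite_cells by simp
    show "{d \<in> ?E. B d e} \<subset> {d \<in> ?E. B d f}"
      using that B_trans B_irrefl by blast
  qed
  \<comment> \<open>\<open>B\<close> is a relation and not a class instance, so the cells are sorted by the number of their predecessors.\<close>
  obtain ys where ys: "set ys = ?E" "distinct ys"
    using finite_distinct_list[OF finite_cells] by blast
  define xs where "xs = sort_key rank ys"
  have xs: "set xs = ?E" "distinct xs" "sorted (map rank xs)"
    using ys by (simp_all add: xs_def)
  have nth_less: "a < b" if "B (xs ! a) (xs ! b)" "a < length xs" "b < length xs" for a b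
  proof (rule ccontr)
    assume "\<not> a < b"
    then have "rank (xs ! b) \<le> rank (xs ! a)"
      using sorted_nth_mono[OF xs(3), of b a] that by simp
    moreover have "rank (xs ! a) < rank (xs ! b)"
      using that rank_less xs(1) nth_mem by blast
    ultimately show False by simp
  qed
  have down: "(i, p) \<in> set (take k xs)" if q: "(i, q) \<in> set (take k xs)" and "p < q" for k i p q
  proof -
    obtain b where b: "b < k" "b < length xs" "xs ! b = (i, q)"
      using q by (auto simp: in_set_conv_nth)
    then have "(i, q) \<in> ?E" using xs(1) nth_mem by fastforce
    then have "(i, p) \<in> set xs" using \<open>p < q\<close> xs(1) by (auto simp: cells_def)
    then obtain a where a: "a < length xs" "xs ! a = (i, p)" by (auto simp: in_set_conv_nth)
    have "B (i, p) (i, q)" using \<open>p < q\<close> letters[of "(i, p)" "(i, q)"] unfolding B_def by auto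
    then have "a < k" using nth_less[of a b] a b by simp
    then show ?thesis using a by (auto simp: in_set_conv_nth)
  qed
  define w where "w = map fst xs"
  have read: "read_by k w e \<longleftrightarrow> e \<in> set (take k xs)" for k e
  proof -
    have "(i, p) \<in> set (take l (take k xs))"
      if "(i, q) \<in> set (take l (take k xs))" "p < q" for l i p q
      using that down[of i q "min l k" p] by simp
    then show ?thesis
      using read_by_map_fst[of "take k xs" e] xs(2) by (simp add: read_by_def w_def take_map)
  qed
  have "count_list w i = v i" if "i \<in> {1..n}" for i
  proof -
    have "p < count_list w i \<longleftrightarrow> p < v i" for p
      using read[of "length xs" "(i, p)"] that xs(1) by (simp add: read_by_def w_def cells_def)
    then show ?thesis by (metis nat_neq_iff)
  qed
  moreover have "set w \<subseteq> {1..n}" using xs(1) by (auto simp: w_def cells_def)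
  ultimately have "w \<in> multinomial_words n v" by (simp add: multinomial_words_def)
  moreover have B_before: "before w e f" if B: "B e f" and E: "e \<in> ?E" "f \<in> ?E" for e f
  proof -
    obtain a b where ab: "a < length xs" "xs ! a = e" "b < length xs" "xs ! b = f"
      using E xs(1) by (metis in_set_conv_nth)
    then have "a < b" using nth_less B by blast
    then have "e \<in> set (take (Suc a) xs)" and "f \<notin> set (take (Suc a) xs)"
      using ab xs(2) by (auto simp: in_set_conv_nth nth_eq_iff_index_eq)
    then show ?thesis unfolding before_def read by blast
  qed
  then have before_iff: "before w e f \<longleftrightarrow> B e f" if "e \<in> ?E" "f \<in> ?E" "e \<noteq> f" for e f
    using that B_total before_asym by blast
  have "e \<in> ?E \<and> f \<in> ?E \<and> e < f \<and> before w f e \<longleftrightarrow> (e, f) \<in> T" for e f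
    using before_iff[of f e] biclosedD[OF T, of e f] unfolding B_def by (auto dest: order.asym)
  then have "inversions ?E w = T" unfolding inversions_def by auto
  ultimately show ?thesis by blast
qed

section \<open>The order of the multinomial lattice\<close>

lemma swap_step_count_list: "swap_step w u \<Longrightarrow> count_list w i = count_list u i"
  by (induction rule: swap_step.induct) auto

text \<open>A swap changes only the prefix that ends between the two swapped letters \<open>i < j\<close>. If that prefix
  witnessed an inversion \<open>(e, f)\<close>, a neighbouring prefix does so after the swap: the longer one
  when \<open>f\<close> has letter \<open>i\<close>, for then \<open>e\<close> has a letter below \<open>i\<close>, and the shorter one otherwise.\<close>

lemma swap_step_inversions:
  assumes "swap_step w u"
  shows "inversions E w \<subseteq> inversions E u"
proof -
  have "before u f e" if "before w f e" "fst e < fst f" for e f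
    using assms
  proof cases
    case (1 i j w1 w2)
    obtain k where k: "read_by k w f" "\<not> read_by k w e" using \<open>before w f e\<close> before_def by blast
    consider "k \<le> length w1" | "k = Suc (length w1)" | "k \<ge> length w1 + 2" by linarith
    then show ?thesis
    proof cases
      case 1
      then have "take k u = take k w" using \<open>w = _\<close> \<open>u = _\<close> by simp
      then show ?thesis using k unfolding before_def read_by_def by metis
    next
      case 2
      show ?thesis
      proof (cases "fst f = i")
        case True
        then have "read_by (length w1 + 2) u f" "\<not> read_by (length w1 + 2) u e"
          using k 2 \<open>w = _\<close> \<open>u = _\<close> \<open>i < j\<close> \<open>fst e < fst f\<close> by (auto simp: read_by_def)
        then show ?thesis unfolding before_def by blast
      next
        case False
        then have "read_by (length w1) u f" "\<not> read_by (length w1) u e"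
          using k 2 \<open>w = _\<close> \<open>u = _\<close> by (auto simp: read_by_def split: if_splits)
        then show ?thesis unfolding before_def by blast
      qed
    next
      case 3
      then obtain l where "k = length w1 + 2 + l" using le_Suc_ex by blast
      then have "count_list (take k u) a = count_list (take k w) a" for a
        using \<open>w = _\<close> \<open>u = _\<close> by simp
      then show ?thesis using k unfolding before_def read_by_def by metis
    qed
  qed
  then show ?thesis
    using inversions_fst_less unfolding inversions_def by fast
qed

lemma swap_steps_Cons: "swap_step\<^sup>*\<^sup>* w u \<Longrightarrow> swap_step\<^sup>*\<^sup>* (a # w) (a # u)"
proof (induction rule: rtranclp_induct)
  case (step u u')
  then have "swap_step (a # u) (a # u')"
    by (metis append_Cons swap_step.simps)
  then show ?case using step by simp
qed simp

lemma swap_steps_to_front: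
  assumes "\<forall>i \<in> set w1. i < j"
  shows "swap_step\<^sup>*\<^sup>* (w1 @ j # w2) (j # w1 @ w2)"
  using assms
proof (induction w1)
  case (Cons i w1)
  then have "swap_step\<^sup>*\<^sup>* (i # w1 @ j # w2) (i # j # w1 @ w2)"
    by (simp add: swap_steps_Cons)
  moreover have "swap_step (i # j # w1 @ w2) (j # i # w1 @ w2)"
    using swap_step.intros[of i j "[]" "w1 @ w2"] Cons.prems by simp
  ultimately show ?case by simp
qed simp

text \<open>The hypothesis is inclusion of inversion sets in terms of prefix counts, which avoids renumbering
  cells when a letter is deleted. Let \<open>j\<close> be the first letter of the target. The letters in front
  of the first \<open>j\<close> in \<open>w\<close> are all smaller than \<open>j\<close>, because a larger one would be an inversion
  that the target lacks; so \<open>j\<close> can be swapped to the front, and deleting it from both words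
  preserves the hypothesis.\<close>

lemma swap_steps_if_dominated:
  assumes "\<And>i. count_list w i = count_list u i"
    and "\<And>i j k. i < j \<Longrightarrow> \<exists>l. count_list (take k w) j \<le> count_list (take l u) j \<and>
           count_list (take l u) i \<le> count_list (take k w) i"
  shows "swap_step\<^sup>*\<^sup>* w u"
  using assms
proof (induction u arbitrary: w)
  case Nil
  then have "i \<notin> set w" for i by (simp add: count_list_0_iff)
  then have "w = []" by (metis list.set_intros(1) neq_Nil_conv)
  then show ?case by simp
next
  case (Cons j u)
  have "count_list w j \<noteq> 0" using Cons.prems(1)[of j] by simp
  then have "j \<in> set w" by (metis count_list_0_iff)
  then obtain w1 w2 where w: "w = w1 @ j # w2" and "j \<notin> set w1"
    using split_list_first by metis
  have j0: "count_list (take k w1) j = 0" for k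
    using \<open>j \<notin> set w1\<close> by (meson count_list_0_iff in_set_takeD)
  have "i < j" if "i \<in> set w1" for i
  proof (rule ccontr)
    assume "\<not> i < j"
    then have "j < i" using that \<open>j \<notin> set w1\<close> by (metis linorder_neqE_nat)
    then obtain l where l: "count_list w1 i \<le> count_list (take l (j # u)) i"
      "count_list (take l (j # u)) j \<le> count_list w1 j"
      using Cons.prems(2)[of j i "length w1"] w by auto
    then have "l = 0" using j0[of "length w1"] by (cases l) auto
    then show False using l(1) that by (simp add: count_list_0_iff)
  qed
  then have "swap_step\<^sup>*\<^sup>* w (j # w1 @ w2)" unfolding w by (intro swap_steps_to_front) blast
  moreover have "swap_step\<^sup>*\<^sup>* (w1 @ w2) u"
  proof (rule Cons.IH)
    show "count_list (w1 @ w2) i = count_list u i" for i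
      using Cons.prems(1)[of i] w by (simp split: if_splits)
    show "\<exists>l. count_list (take k (w1 @ w2)) b \<le> count_list (take l u) b \<and>
           count_list (take l u) a \<le> count_list (take k (w1 @ w2)) a" if ab: "a < b" for a b k
    proof (cases "k \<le> length w1")
      case True
      obtain l where l: "count_list (take k w1) b \<le> count_list (take l (j # u)) b"
        "count_list (take l (j # u)) a \<le> count_list (take k w1) a"
        using Cons.prems(2)[OF ab, of k] w True by auto
      show ?thesis
      proof (cases "b = j \<or> l = 0")
        case True
        then have "count_list (take k w1) b = 0" using l(1) j0 by auto
        then show ?thesis using \<open>k \<le> length w1\<close> by (intro exI[of _ 0]) simp
      next
        case False
        then obtain l' where "l = Suc l'" by (cases l) auto
        then show ?thesis using l False \<open>k \<le> length w1\<close>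
          by (intro exI[of _ l']) (auto split: if_splits)
      qed
    next
      case False
      then have count: "count_list (take (Suc k) w) c =
          count_list (take k (w1 @ w2)) c + (if c = j then 1 else 0)" for c
        using w by (simp add: Suc_diff_le)
      obtain l where l: "count_list (take (Suc k) w) b \<le> count_list (take l (j # u)) b"
        "count_list (take l (j # u)) a \<le> count_list (take (Suc k) w) a"
        using Cons.prems(2)[OF ab, of "Suc k"] by blast
      show ?thesis
      proof (cases l)
        case 0
        then show ?thesis using l(1) count[of b] by (intro exI[of _ 0]) simp
      next
        case (Suc l')
        then show ?thesis using l count[of a] count[of b]
          by (intro exI[of _ l']) (auto split: if_splits)
      qed
    qed
  qed
  ultimately show ?case using swap_steps_Cons by (metis rtranclp_trans)
qed

lemma count_list_outside:
  assumes "w \<in> multinomial_words n v" and "i \<notin> {1..n}"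
  shows "count_list w i = 0"
  using assms by (auto simp: multinomial_words_def count_list_0_iff)

lemma swap_steps_iff_inversions:
  assumes w: "w \<in> multinomial_words n v" and u: "u \<in> multinomial_words n v"
  shows "swap_step\<^sup>*\<^sup>* w u \<longleftrightarrow> inversions (cells n v) w \<subseteq> inversions (cells n v) u"
proof
  show "inversions (cells n v) w \<subseteq> inversions (cells n v) u" if "swap_step\<^sup>*\<^sup>* w u"
    using that by induction (use swap_step_inversions in blast)+
next
  assume sub: "inversions (cells n v) w \<subseteq> inversions (cells n v) u"
  show "swap_step\<^sup>*\<^sup>* w u"
  proof (rule swap_steps_if_dominated)
    show count: "count_list w i = count_list u i" for i
      using w u count_list_outside[OF w, of i] count_list_outside[OF u, of i]
      by (cases "i \<in> {1..n}") (auto simp: multinomial_words_def)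
    show "\<exists>l. count_list (take k w) j \<le> count_list (take l u) j \<and>
           count_list (take l u) i \<le> count_list (take k w) i" if "i < j" for i j k
    proof -
      \<comment> \<open>The tightest inversion witnessed by this prefix: the last \<open>j\<close> read and the first \<open>i\<close> not read.\<close>
      let ?p = "count_list (take k w) i" and ?q = "count_list (take k w) j"
      have le: "count_list (take k w) c \<le> count_list w c" for c
        by (metis append_take_drop_id count_list_append le_add1)
      consider "?q = 0" | "?p = count_list w i" | "0 < ?q" "?p < count_list w i"
        using le[of i] by linarith
      then show ?thesis
      proof cases
        case 1
        then show ?thesis by (intro exI[of _ 0]) simp
      next
        case 2
        then show ?thesis using count le by (intro exI[of _ "length u"]) simp
      next
        case 3
        then have ij: "i \<in> {1..n}" "j \<in> {1..n}"
          using le[of j] count_list_outside[OF w, of i] count_list_outside[OF w, of j]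
          by fastforce+
        then have "?p < v i" "?q - 1 < v j"
          using 3 le[of j] w by (auto simp: multinomial_words_def)
        moreover have "before w (j, ?q - 1) (i, ?p)"
          using 3 unfolding before_def read_by_def by (intro exI[of _ k]) auto
        ultimately have "((i, ?p), (j, ?q - 1)) \<in> inversions (cells n v) w"
          using ij \<open>i < j\<close> by (simp add: inversions_def cells_def less_prod_def)
        then have "before u (j, ?q - 1) (i, ?p)" using sub unfolding inversions_def by blast
        then obtain l where "?q - 1 < count_list (take l u) j" "count_list (take l u) i \<le> ?p"
          unfolding before_def read_by_def by fastforce
        then show ?thesis by (intro exI[of _ l]) simp
      qed
    qed
  qed
qed

text \<open>Every swap makes a word lexicographically larger.\<close>

lemma swap_steps_antisym:
  assumes "swap_step\<^sup>*\<^sup>* w u" and "swap_step\<^sup>*\<^sup>* u w"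
  shows "w = u"
proof (rule ccontr)
  let ?r = "{(i::nat, j). i < j}"
  have step: "(w, u) \<in> lexord ?r" if "swap_step w u" for w u
    using that by cases (simp add: lexord_append_leftI)
  have "(w, u) \<in> lexord ?r" if "swap_step\<^sup>+\<^sup>+ w u" for w u
    using that
  proof induction
    case (step u u')
    moreover have "trans ?r" by (auto simp: trans_def)
    ultimately show ?case using \<open>\<And>w u. swap_step w u \<Longrightarrow> (w, u) \<in> lexord ?r\<close> lexord_trans by blast
  qed (rule step)
  moreover assume "w \<noteq> u"
  then have "swap_step\<^sup>+\<^sup>+ w w" using assms by (metis rtranclpD tranclp_trans)
  ultimately have "(w, w) \<in> lexord ?r" by blast
  then show False using lexord_irreflexive[of ?r w] by simp
qed

section \<open>Joins and meets\<close>

lemma carrier_multinomial_lattice [simp]: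
  "carrier (multinomial_lattice n v) = multinomial_words n v"
  by (simp add: multinomial_lattice_def)

lemma le_multinomial_lattice:
  assumes "w \<in> multinomial_words n v" and "u \<in> multinomial_words n v"
  shows "w \<sqsubseteq>\<^bsub>multinomial_lattice n v\<^esub> u \<longleftrightarrow>
    inversions (cells n v) w \<subseteq> inversions (cells n v) u"
  using swap_steps_iff_inversions[OF assms] by (simp add: multinomial_lattice_def)

lemma partial_order_multinomial_lattice: "partial_order (multinomial_lattice n v)"
  by unfold_locales (auto simp: multinomial_lattice_def intro: swap_steps_antisym)

lemma ex_inversions_join:
  "\<exists>w \<in> multinomial_words n v. inversions (cells n v) w =
     (inversions (cells n v) x \<union> inversions (cells n v) y)\<^sup>+"
proof (rule biclosed_realizable)
  show "biclosed (cells n v) ((inversions (cells n v) x \<union> inversions (cells n v) y)\<^sup>+)"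
    by (intro biclosed_trancl_Un biclosed_inversions)
  show "fst e < fst f" if "(e, f) \<in> (inversions (cells n v) x \<union> inversions (cells n v) y)\<^sup>+" for e f
    using that by induction (use inversions_fst_less in \<open>fastforce+\<close>)
qed

lemma ex_inversions_meet:
  "\<exists>w \<in> multinomial_words n v. inversions (cells n v) w = co_pairs (cells n v)
     ((co_pairs (cells n v) (inversions (cells n v) x) \<union>
       co_pairs (cells n v) (inversions (cells n v) y))\<^sup>+)"
proof (rule biclosed_realizable)
  let ?E = "cells n v"
  let ?N = "\<lambda>x. co_pairs ?E (inversions ?E x)"
  show "biclosed ?E (co_pairs ?E ((?N x \<union> ?N y)\<^sup>+))"
    by (intro biclosed_co_pairs biclosed_trancl_Un biclosed_inversions)
  show "fst e < fst f" if ef: "(e, f) \<in> co_pairs ?E ((?N x \<union> ?N y)\<^sup>+)" for e f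
  proof -
    have "(e, f) \<in> inversions ?E x" using ef co_pairs_trancl_subset by blast
    then show ?thesis by (rule inversions_fst_less)
  qed
qed

lemma lattice_multinomial_lattice: "lattice (multinomial_lattice n v)"
proof -
  let ?L = "multinomial_lattice n v" and ?E = "cells n v"
  let ?I = "inversions ?E"
  interpret partial_order ?L by (rule partial_order_multinomial_lattice)
  show ?thesis
  proof
    fix x y assume xy: "x \<in> carrier ?L" "y \<in> carrier ?L"
    obtain w where w: "w \<in> multinomial_words n v" "?I w = (?I x \<union> ?I y)\<^sup>+"
      using ex_inversions_join by blast
    have "least ?L w (Upper ?L {x, y})"
    proof (rule least_UpperI)
      show "c \<sqsubseteq>\<^bsub>?L\<^esub> w" if "c \<in> {x, y}" for c
        using that xy w by (auto simp: le_multinomial_lattice)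
      show "w \<sqsubseteq>\<^bsub>?L\<^esub> c" if c: "c \<in> Upper ?L {x, y}" for c
      proof -
        have "x \<sqsubseteq>\<^bsub>?L\<^esub> c" "y \<sqsubseteq>\<^bsub>?L\<^esub> c" "c \<in> multinomial_words n v"
          using Upper_memD[OF c] xy Upper_closed[of ?L "{x, y}"] c by auto
        then have "c \<in> multinomial_words n v" "?I x \<subseteq> ?I c" "?I y \<subseteq> ?I c"
          using xy le_multinomial_lattice by auto
        then show ?thesis
          using trancl_Un_least[OF _ _ biclosed_trans[OF biclosed_inversions]] w
          by (simp add: le_multinomial_lattice)
      qed
    qed (use xy w in auto)
    then show "\<exists>s. least ?L s (Upper ?L {x, y})" ..
  next
    fix x y assume xy: "x \<in> carrier ?L" "y \<in> carrier ?L"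
    let ?N = "\<lambda>x. co_pairs ?E (?I x)"
    obtain w where w: "w \<in> multinomial_words n v" "?I w = co_pairs ?E ((?N x \<union> ?N y)\<^sup>+)"
      using ex_inversions_meet by blast
    have "greatest ?L w (Lower ?L {x, y})"
    proof (rule greatest_LowerI)
      have "?I w \<subseteq> ?I x" "?I w \<subseteq> ?I y" using w(2) co_pairs_trancl_subset by fast+
      then show "w \<sqsubseteq>\<^bsub>?L\<^esub> c" if "c \<in> {x, y}" for c
        using that xy w(1) by (auto simp: le_multinomial_lattice)
      show "c \<sqsubseteq>\<^bsub>?L\<^esub> w" if c: "c \<in> Lower ?L {x, y}" for c
      proof -
        have "c \<sqsubseteq>\<^bsub>?L\<^esub> x" "c \<sqsubseteq>\<^bsub>?L\<^esub> y" "c \<in> multinomial_words n v"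
          using Lower_memD[OF c] xy Lower_closed[of ?L "{x, y}"] c by auto
        then have c': "c \<in> multinomial_words n v" "?I c \<subseteq> ?I x" "?I c \<subseteq> ?I y"
          using xy le_multinomial_lattice by auto
        then have "(?N x \<union> ?N y)\<^sup>+ \<subseteq> ?N c"
          by (intro trancl_Un_least co_pairs_antimono biclosed_trans[OF biclosed_co_pairs]
              biclosed_inversions)
        then have "?I c \<subseteq> ?I w" unfolding w(2) by (auto simp: co_pairs_def inversions_def)
        then show ?thesis using c' w by (simp add: le_multinomial_lattice)
      qed
    qed (use xy w in auto)
    then show "\<exists>s. greatest ?L s (Lower ?L {x, y})" ..
  qed
qed

section \<open>Joins and meets restricted to narrow pairs\<close>

text \<open>The induction of the main argument runs over the difference of the letters of a pair, and
  \<open>narrow_sub W m Y\<close> is the shape of its hypothesis: pairs of \<open>W\<close> with difference at most \<open>m\<close> are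
  in \<open>Y\<close>.\<close>

definition narrow_sub ::
  "((nat \<times> nat) \<times> (nat \<times> nat)) set \<Rightarrow> nat \<Rightarrow> ((nat \<times> nat) \<times> (nat \<times> nat)) set \<Rightarrow> bool" where
  "narrow_sub W m Y \<longleftrightarrow> (\<forall>c d. (c, d) \<in> W \<longrightarrow> fst d \<le> fst c + m \<longrightarrow> (c, d) \<in> Y)"

text \<open>Follow a chain from \<open>a\<close> to \<open>b\<close>. As long as the conclusion fails, a point \<open>c\<close> of the chain with
  \<open>c = a\<close> or \<open>(a, c) \<in> W\<close> is followed by a point \<open>d\<close> with \<open>(a, d) \<in> W\<close>: otherwise \<open>(d, b) \<in> W\<close>
  by coclosedness, and the narrower pairs \<open>(a, c)\<close> and \<open>(d, b)\<close> are in \<open>Y \<inter> Z\<close>, so whichever of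
  \<open>Y\<close> and \<open>Z\<close> contains the step \<open>(c, d)\<close> also contains \<open>(a, b)\<close>. This goes on until the last
  step, which ends at \<open>b\<close> and therefore gives \<open>(a, b)\<close> in the same way.\<close>

lemma join_pair_one_side:
  assumes W: "biclosed E W"
    and S: "\<And>c d. (c, d) \<in> S \<union> T \<Longrightarrow> c \<in> E \<and> d \<in> E \<and> fst c < fst d"
    and Y: "S \<subseteq> Y" "trans Y" "narrow_sub W m Y"
    and Z: "T \<subseteq> Z" "trans Z" "narrow_sub W m Z"
    and ab: "(a, b) \<in> W" "fst b \<le> fst a + Suc m" "(a, b) \<in> (S \<union> T)\<^sup>+"
  shows "(a, b) \<in> Y \<or> (a, b) \<in> Z"
proof (rule ccontr)
  assume neg: "\<not> ?thesis"
  have less: "c \<in> E \<and> d \<in> E \<and> fst c < fst d" if "(c, d) \<in> (S \<union> T)\<^sup>+" for c d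
    using that
  proof induction
    case (step d d')
    then show ?case using S[of d d'] by auto
  qed (use S in blast)
  have left: "c = a \<or> (a, c) \<in> W" if "(a, c) \<in> (S \<union> T)\<^sup>*" "(c, b) \<in> (S \<union> T)\<^sup>+" for c
    using that
  proof induction
    case (step c d)
    have cd: "(c, d) \<in> S \<union> T" by fact
    then have "(c, b) \<in> (S \<union> T)\<^sup>+" using step.prems by (rule trancl_into_trancl2)
    then have c: "c = a \<or> (a, c) \<in> W" by (rule step.IH)
    have "(a, d) \<in> (S \<union> T)\<^sup>+" using step.hyps by (rule rtrancl_into_trancl1)
    then have ad: "fst a < fst d" "d \<in> E" and db: "fst d < fst b"
      using less step.prems by blast+
    have ac: "(a, c) \<in> Y \<inter> Z" if "c \<noteq> a"
      using c that Y(3) Z(3) ab(2) less[OF r_into_trancl[OF cd]] db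
      unfolding narrow_sub_def by fastforce
    have "(d, b) \<notin> W"
    proof
      assume "(d, b) \<in> W"
      then have "(d, b) \<in> Y \<inter> Z" using Y(3) Z(3) ab(2) ad unfolding narrow_sub_def by fastforce
      then have "(a, b) \<in> Y \<or> (a, b) \<in> Z"
        using ac cd Y(1,2) Z(1,2) by (cases "c = a") (blast dest: transD)+
      then show False using neg by blast
    qed
    then show ?case
      using biclosed_split[OF W ab(1), of d] ad db by (auto simp: less_prod_def)
  qed simp
  obtain c where c: "(a, c) \<in> (S \<union> T)\<^sup>*" "(c, b) \<in> S \<union> T"
    using tranclD2[OF ab(3)] by blast
  then have "c = a \<or> (a, c) \<in> Y \<inter> Z"
    using left[of c] S[of c b] Y(3) Z(3) ab(2) unfolding narrow_sub_def by fastforce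
  then have "(a, b) \<in> Y \<or> (a, b) \<in> Z"
    using c(2) Y(1,2) Z(1,2) by (blast dest: transD)
  then show False using neg by blast
qed

text \<open>A pair of \<open>W\<close> inside the interval from \<open>a\<close> to \<open>b\<close> is in \<open>Z\<close>, either because it is narrower than
  \<open>(a, b)\<close> or because it has the same letters as \<open>(a, b)\<close>, when splitting \<open>(a, b) \<in> Z\<close> at cells of
  equal letters gives it. Hence on this interval every pair outside \<open>X\<close> or outside \<open>Z\<close> is also
  outside \<open>W\<close>. Chains of such pairs stay outside \<open>W\<close>, as the complement of \<open>W\<close> is transitive, and
  so they cannot join \<open>a\<close> to \<open>b\<close>.\<close>

lemma meet_pair:
  assumes W: "biclosed E W" and X: "W \<subseteq> X"
    and Z: "biclosed E Z" "\<And>c d. (c, d) \<in> Z \<Longrightarrow> fst c < fst d" "narrow_sub W m Z"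
    and ab: "(a, b) \<in> W" "fst b \<le> fst a + Suc m" "(a, b) \<in> Z"
  shows "(a, b) \<in> co_pairs E ((co_pairs E X \<union> co_pairs E Z)\<^sup>+)"
proof -
  have inside: "(c, d) \<in> Z" if cd: "(c, d) \<in> W" "a \<le> c" "d \<le> b" for c d
  proof (cases "fst a < fst c \<or> fst d < fst b")
    case True
    then have "fst d \<le> fst c + m"
      using ab(2) cd(2,3) by (auto simp: less_eq_prod_def)
    then show ?thesis using Z(3) cd(1) unfolding narrow_sub_def by blast
  next
    case False
    then have f: "fst c = fst a" "fst d = fst b" using cd by (auto simp: less_eq_prod_def)
    have E: "c \<in> E" "d \<in> E" "a \<in> E" "b \<in> E" using biclosedD[OF W] cd ab by blast+
    have lt: "fst a < fst b" using Z(2) ab(3) .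
    have "(c, b) \<in> Z"
    proof (cases "c = a")
      case False
      then show ?thesis
        using biclosed_split[OF Z(1) ab(3) E(1)] Z(2)[of a c] cd(2) f lt
        by (auto simp: less_prod_def order.order_iff_strict)
    qed (use ab in simp)
    then show ?thesis
      using biclosed_split[OF Z(1), of c b d] Z(2)[of d b] cd(3) f lt E
      by (cases "d = b") (auto simp: less_prod_def order.order_iff_strict)
  qed
  have no_inv: "(a, c) \<in> co_pairs E W" if "(a, c) \<in> (co_pairs E X \<union> co_pairs E Z)\<^sup>+" "c \<le> b" for c
    using that
  proof induction
    case (base c)
    then show ?case using X inside[of a c] by (auto simp: co_pairs_def)
  next
    case (step c d)
    then have "c < d" by (auto simp: co_pairs_def)
    then have ac: "(a, c) \<in> co_pairs E W" using step by auto
    then have "a \<le> c" by (auto simp: co_pairs_def)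
    then have "(c, d) \<in> co_pairs E W"
      using step.hyps(2) step.prems X inside[of c d] by (auto simp: co_pairs_def)
    then show ?case using ac transD[OF biclosed_trans[OF biclosed_co_pairs[OF W]]] by blast
  qed
  have "(a, b) \<notin> (co_pairs E X \<union> co_pairs E Z)\<^sup>+"
  proof
    assume "(a, b) \<in> (co_pairs E X \<union> co_pairs E Z)\<^sup>+"
    then have "(a, b) \<in> co_pairs E W" by (rule no_inv) simp
    then show False using ab(1) by (simp add: co_pairs_def)
  qed
  then show ?thesis using biclosedD[OF W ab(1)] by (simp add: co_pairs_def)
qed

section \<open>Meet semidistributivity\<close>

lemma (in lattice) sd_closed:
  assumes "x \<in> carrier L" "y \<in> carrier L" "z \<in> carrier L"
  shows "sd_y L x y z m \<in> carrier L" and "sd_z L x y z m \<in> carrier L"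
  using assms by (induction m) auto

lemma (in lattice) sd_mono_Suc:
  assumes "x \<in> carrier L" "y \<in> carrier L" "z \<in> carrier L"
  shows "sd_y L x y z m \<sqsubseteq> sd_y L x y z (Suc m)" and "sd_z L x y z m \<sqsubseteq> sd_z L x y z (Suc m)"
proof (induction m)
  case 0
  { case 1 show ?case using assms by (simp add: join_left)
  next case 2 show ?case using assms by (simp add: join_left) }
next
  case (Suc m)
  have mono: "c \<squnion> (x \<sqinter> d) \<sqsubseteq> c \<squnion> (x \<sqinter> e)"
    if "d \<sqsubseteq> e" "c \<in> carrier L" "d \<in> carrier L" "e \<in> carrier L" for c d e
  proof -
    have "x \<sqinter> d \<sqsubseteq> e" using le_trans[OF meet_right[of x d] that(1)] that assms by simp
    then have "x \<sqinter> d \<sqsubseteq> x \<sqinter> e" using that assms by (simp add: meet_le meet_left)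
    then have "x \<sqinter> d \<sqsubseteq> c \<squnion> (x \<sqinter> e)"
      using le_trans[OF _ join_right[of c "x \<sqinter> e"]] that assms by simp
    then show ?thesis using that assms by (simp add: join_le join_left)
  qed
  { case 1 show ?case using mono[OF Suc(2)] assms sd_closed[OF assms] by simp
  next case 2 show ?case using mono[OF Suc(1)] assms sd_closed[OF assms] by simp }
qed

lemma (in lattice) sd_le_join:
  assumes "x \<in> carrier L" "y \<in> carrier L" "z \<in> carrier L"
  shows "sd_y L x y z m \<sqsubseteq> y \<squnion> z" and "sd_z L x y z m \<sqsubseteq> y \<squnion> z"
proof (induction m)
  case 0
  { case 1 show ?case using assms by (simp add: join_left)
  next case 2 show ?case using assms by (simp add: join_right) }
next
  case (Suc m)
  have "x \<sqinter> c \<sqsubseteq> y \<squnion> z" if "c \<sqsubseteq> y \<squnion> z" "c \<in> carrier L" for c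
    using le_trans[OF meet_right[of x c] that(1)] that assms by simp
  then have "x \<sqinter> sd_y L x y z m \<sqsubseteq> y \<squnion> z" "x \<sqinter> sd_z L x y z m \<sqsubseteq> y \<squnion> z"
    using Suc sd_closed[OF assms] by blast+
  then show "sd_y L x y z (Suc m) \<sqsubseteq> y \<squnion> z" "sd_z L x y z (Suc m) \<sqsubseteq> y \<squnion> z"
    using assms sd_closed[OF assms] by (simp_all add: join_le join_left join_right)
qed

text \<open>The two sequences have to be treated together: the induction step for either of them uses the
  hypothesis for both, since it is not known in advance on which side \<open>join_pair_one_side\<close>
  places a pair.\<close>

lemma narrow_inversions_sd:
  fixes n :: nat and v :: "nat \<Rightarrow> nat"
  defines "L \<equiv> multinomial_lattice n v" and "I \<equiv> inversions (cells n v)"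
  assumes xyz: "x \<in> carrier L" "y \<in> carrier L" "z \<in> carrier L"
  shows "narrow_sub (I (x \<sqinter>\<^bsub>L\<^esub> (y \<squnion>\<^bsub>L\<^esub> z))) m (I (sd_y L x y z m)) \<and>
         narrow_sub (I (x \<sqinter>\<^bsub>L\<^esub> (y \<squnion>\<^bsub>L\<^esub> z))) m (I (sd_z L x y z m))"
proof (induction m)
  case 0
  then show ?case
    using inversions_fst_less unfolding narrow_sub_def I_def by fastforce
next
  case (Suc m)
  interpret lattice L unfolding L_def by (rule lattice_multinomial_lattice)
  have le: "a \<sqsubseteq>\<^bsub>L\<^esub> b \<longleftrightarrow> I a \<subseteq> I b" if "a \<in> carrier L" "b \<in> carrier L" for a b
    using that le_multinomial_lattice unfolding L_def I_def by simp
  have bi: "biclosed (cells n v) (I a)" for a unfolding I_def by (rule biclosed_inversions)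
  have I_join: "I (a \<squnion>\<^bsub>L\<^esub> b) \<subseteq> (I a \<union> I b)\<^sup>+" if "a \<in> carrier L" "b \<in> carrier L" for a b
  proof -
    obtain c where c: "c \<in> carrier L" "I c = (I a \<union> I b)\<^sup>+"
      using ex_inversions_join unfolding L_def I_def by force
    then have "a \<squnion>\<^bsub>L\<^esub> b \<sqsubseteq>\<^bsub>L\<^esub> c" using that by (intro join_le) (auto simp: le)
    then show ?thesis using that c le by auto
  qed
  let ?N = "\<lambda>a. co_pairs (cells n v) (I a)"
  have I_meet: "co_pairs (cells n v) ((?N a \<union> ?N b)\<^sup>+) \<subseteq> I (a \<sqinter>\<^bsub>L\<^esub> b)"
    if ab: "a \<in> carrier L" "b \<in> carrier L" for a b
  proof -
    obtain c where c: "c \<in> carrier L" "I c = co_pairs (cells n v) ((?N a \<union> ?N b)\<^sup>+)"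
      using ex_inversions_meet unfolding L_def I_def by force
    have "I c \<subseteq> I a" "I c \<subseteq> I b" using c(2) co_pairs_trancl_subset by fast+
    then have "c \<sqsubseteq>\<^bsub>L\<^esub> a \<sqinter>\<^bsub>L\<^esub> b" using ab c(1) by (intro meet_le) (auto simp: le)
    then show ?thesis using ab c le by auto
  qed
  define w where "w = x \<sqinter>\<^bsub>L\<^esub> (y \<squnion>\<^bsub>L\<^esub> z)"
  note closed = sd_closed[OF xyz, of m]
  have w: "I w \<subseteq> I x" "I w \<subseteq> (I y \<union> I z)\<^sup>+"
  proof -
    have "w \<sqsubseteq>\<^bsub>L\<^esub> x" "w \<sqsubseteq>\<^bsub>L\<^esub> y \<squnion>\<^bsub>L\<^esub> z" "w \<in> carrier L"
      unfolding w_def using xyz by (simp_all add: meet_left meet_right)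
    then have "I w \<subseteq> I x" "I w \<subseteq> I (y \<squnion>\<^bsub>L\<^esub> z)" using xyz le by simp_all
    then show "I w \<subseteq> I x" "I w \<subseteq> (I y \<union> I z)\<^sup>+" using I_join[OF xyz(2,3)] by blast+
  qed
  have base: "I y \<subseteq> I (sd_y L x y z m)" "I z \<subseteq> I (sd_z L x y z m)"
  proof -
    have "y \<sqsubseteq>\<^bsub>L\<^esub> sd_y L x y z m" "z \<sqsubseteq>\<^bsub>L\<^esub> sd_z L x y z m"
      using xyz closed by (cases m; simp add: join_left sd_closed)+
    then show "I y \<subseteq> I (sd_y L x y z m)" "I z \<subseteq> I (sd_z L x y z m)" using xyz closed le by auto
  qed
  have next_step: "(a, b) \<in> I (sd_y L x y z (Suc m)) \<and> (a, b) \<in> I (sd_z L x y z (Suc m))"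
    if ab: "(a, b) \<in> I w" "fst b \<le> fst a + Suc m" for a b
  proof -
    have IH: "narrow_sub (I w) m (I (sd_y L x y z m))" "narrow_sub (I w) m (I (sd_z L x y z m))"
      using Suc unfolding w_def by blast+
    have mono: "I (sd_y L x y z m) \<subseteq> I (sd_y L x y z (Suc m))"
      "I (sd_z L x y z m) \<subseteq> I (sd_z L x y z (Suc m))"
      using sd_mono_Suc[OF xyz, of m] le sd_closed[OF xyz] by blast+
    \<comment> \<open>A pair that landed on the side \<open>s\<close> is carried over to the next term on the other side.\<close>
    have cross: "(a, b) \<in> I (t \<squnion>\<^bsub>L\<^esub> (x \<sqinter>\<^bsub>L\<^esub> s))"
      if "(a, b) \<in> I s" "narrow_sub (I w) m (I s)" "s \<in> carrier L" "t \<in> carrier L" for s t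
    proof -
      have "(a, b) \<in> co_pairs (cells n v) ((?N x \<union> ?N s)\<^sup>+)"
        using meet_pair[OF bi w(1) bi _ that(2) ab that(1)] inversions_fst_less
        unfolding I_def by blast
      then have "(a, b) \<in> I (x \<sqinter>\<^bsub>L\<^esub> s)" using I_meet xyz that by blast
      moreover have "x \<sqinter>\<^bsub>L\<^esub> s \<sqsubseteq>\<^bsub>L\<^esub> t \<squnion>\<^bsub>L\<^esub> (x \<sqinter>\<^bsub>L\<^esub> s)"
        using xyz that by (simp add: join_right)
      ultimately show ?thesis using le xyz that by auto
    qed
    have "(a, b) \<in> I (sd_y L x y z m) \<or> (a, b) \<in> I (sd_z L x y z m)"
    proof (rule join_pair_one_side[OF bi _ base(1) biclosed_trans[OF bi] IH(1)
          base(2) biclosed_trans[OF bi] IH(2) ab])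
      show "c \<in> cells n v \<and> d \<in> cells n v \<and> fst c < fst d" if "(c, d) \<in> I y \<union> I z" for c d
        using that biclosedD[OF bi] inversions_fst_less unfolding I_def by blast
      show "(a, b) \<in> (I y \<union> I z)\<^sup>+" using ab w(2) by blast
    qed
    then show ?thesis
      using mono cross[OF _ IH(1) closed(1) xyz(3)] cross[OF _ IH(2) closed(2) xyz(2)] by auto
  qed
  then show ?case unfolding narrow_sub_def w_def by blast
qed

theorem corollary4p15:
  fixes n k :: nat and v :: "nat \<Rightarrow> nat"
  assumes "n \<ge> 1" and "k \<ge> n - 1"
  shows "meet_semidistributive_at (multinomial_lattice n v) k"
proof -
  define L where "L = multinomial_lattice n v"
  interpret lattice L unfolding L_def by (rule lattice_multinomial_lattice)
  have "x \<sqinter>\<^bsub>L\<^esub> sd_y L x y z k = x \<sqinter>\<^bsub>L\<^esub> (y \<squnion>\<^bsub>L\<^esub> z)"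
    if xyz: "x \<in> carrier L" "y \<in> carrier L" "z \<in> carrier L" for x y z
  proof (rule le_antisym)
    let ?w = "x \<sqinter>\<^bsub>L\<^esub> (y \<squnion>\<^bsub>L\<^esub> z)" and ?I = "inversions (cells n v)"
    note closed = sd_closed[OF xyz, of k]
    have w: "?w \<in> carrier L" using xyz by simp
    \<comment> \<open>Letters lie in \<open>{1..n}\<close>, so every inversion is narrow for \<open>k \<ge> n - 1\<close>.\<close>
    have "fst d \<le> fst c + k" if "(c, d) \<in> ?I ?w" for c d
      using that assms by (auto simp: inversions_def cells_def)
    then have "?I ?w \<subseteq> ?I (sd_y L x y z k)"
      using narrow_inversions_sd[of x n v y z k] xyz unfolding L_def narrow_sub_def by auto
    then have "?w \<sqsubseteq>\<^bsub>L\<^esub> sd_y L x y z k"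
      using le_multinomial_lattice[of ?w n v "sd_y L x y z k"] w closed unfolding L_def by simp
    then show "?w \<sqsubseteq>\<^bsub>L\<^esub> x \<sqinter>\<^bsub>L\<^esub> sd_y L x y z k"
      using xyz closed by (simp add: meet_le meet_left)
    show "x \<sqinter>\<^bsub>L\<^esub> sd_y L x y z k \<sqsubseteq>\<^bsub>L\<^esub> ?w"
      using le_trans[OF meet_right[of x "sd_y L x y z k"] sd_le_join(1)[OF xyz, of k]] xyz closed
      by (simp add: meet_le meet_left)
  qed (use xyz sd_closed[OF xyz] in auto)
  then show ?thesis
    using lattice_multinomial_lattice unfolding meet_semidistributive_at_def SD_meet_def L_def by blast
qed

end
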